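(* Let $n \geq 2$ and let $q$ be a prime power. There exists an $(n,1)$-set of size $(q-1)^{n-1}$ in $\mathrm{PG}(n,q)$, i.e. a set of $(q-1)^{n-1}$ points of $\mathrm{PG}(n,q)$ no $n+1$ of which are collinear.
   Context: $\mathrm{PG}(n,q)$ is the projective space whose points and lines are the $1$- and $2$-dimensional subspaces of $\mathbb{F}_q^{n+1}$. An $(r,s)$-set is a set of points such that every $s$-dimensional projective subspace contains at most $r$ of its points; so an $(n,1)$-set is a point set meeting every line in at most $n$ points. *)

theory Defs
  imports "HOL-Analysis.Cartesian_Space" "HOL-Number_Theory.Prime_Powers"
begin

text \<open>
  With \<open>CARD('k) = q\<close> and \<open>CARD('m) = n + 1\<close>, the vector space \<open>'k ^ 'm\<close> is the
  underlying space of \<open>PG(n,q)\<close>. A projective subspace is represented by the corresponding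
  linear subspace, and a point lies on it iff it is contained in it as a subspace.
\<close>

definition pg_subspaces :: "nat \<Rightarrow> ('k::field ^ 'm) set set" where
  "pg_subspaces s = {U. vec.subspace U \<and> vec.dim U = s + 1}"

abbreviation pg_points :: "('k::field ^ 'm) set set" where
  "pg_points \<equiv> pg_subspaces 0"

abbreviation pg_lines :: "('k::field ^ 'm) set set" where
  "pg_lines \<equiv> pg_subspaces 1"

definition rs_set :: "nat \<Rightarrow> nat \<Rightarrow> ('k::{field,finite} ^ 'm) set set \<Rightarrow> bool" where
  "rs_set r s X \<longleftrightarrow>
     X \<subseteq> pg_points \<and> (\<forall>S \<in> pg_subspaces s. card {P \<in> X. P \<subseteq> S} \<le> r)"

definition pg_collinear :: "('k::field ^ 'm) set set \<Rightarrow> bool" where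
  "pg_collinear Y \<longleftrightarrow> (\<exists>L \<in> pg_lines. \<forall>P \<in> Y. P \<subseteq> L)"

end

theory Submission
  imports Defs "HOL-Computational_Algebra.Polynomial"
begin

text \<open>
  In affine coordinates take the points of the hypersurface \<open>x\<^sub>1 \<cdots> x\<^sub>n = 1\<close>. All but one coordinate
  can be chosen freely among the nonzero elements, so there are \<open>(q - 1)\<^bsup>n - 1\<^esup>\<close> of them. On a line
  \<open>u + t d\<close> the equation becomes \<open>\<Prod>\<^sub>i (u\<^sub>i + t d\<^sub>i) = 1\<close>, of degree at most \<open>n\<close> in \<open>t\<close>. It is not
  an identity: if \<open>d\<^sub>i \<noteq> 0\<close>, the left-hand side vanishes at \<open>t = - u\<^sub>i / d\<^sub>i\<close>. So a line contains at
  most \<open>n\<close> of the points.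
\<close>

lemma card_prod_affine_eq_one_le:
  fixes u d :: "'i \<Rightarrow> 'k::field"
  assumes "finite I" "i \<in> I" "d i \<noteq> 0"
  shows "card {t. (\<Prod>j\<in>I. u j + t * d j) = 1} \<le> card I"
proof -
  define p where "p = (\<Prod>j\<in>I. [:u j, d j:]) - 1"
  have poly_p: "poly p t = (\<Prod>j\<in>I. u j + t * d j) - 1" for t
    by (simp add: p_def poly_prod)
  have "u i + (- u i / d i) * d i = 0"
    using assms(3) by simp
  then have "(\<Prod>j\<in>I. u j + (- u i / d i) * d j) = 0"
    using assms(1,2) prod_zero by fast
  then have "poly p (- u i / d i) \<noteq> 0"
    by (simp only: poly_p) simp
  then have "p \<noteq> 0"
    by auto
  have "degree (\<Prod>j\<in>I. [:u j, d j:]) \<le> (\<Sum>j\<in>I. degree [:u j, d j:])"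
    using degree_prod_sum_le[OF assms(1), of "\<lambda>j. [:u j, d j:]"] by (simp only: o_def)
  also have "\<dots> \<le> (\<Sum>j\<in>I. 1)"
    by (rule sum_mono) auto
  finally have "degree p \<le> card I"
    unfolding p_def by (intro degree_diff_le) auto
  moreover have "{t. (\<Prod>j\<in>I. u j + t * d j) = 1} = {t. poly p t = 0}"
    by (simp add: poly_p)
  ultimately show ?thesis
    using card_poly_roots_bound[OF \<open>p \<noteq> 0\<close>] by simp
qed

text \<open>The hyperplane at infinity is the one where coordinate \<open>h\<close> vanishes.\<close>

definition torus_vectors :: "'m::finite \<Rightarrow> ('k::field ^ 'm) set" where
  "torus_vectors h = {v. v $ h = 1 \<and> (\<Prod>i\<in>UNIV - {h}. v $ i) = 1}"

lemma torus_vectors_nonzero: "v \<in> torus_vectors h \<Longrightarrow> v \<noteq> 0"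
  by (auto simp: torus_vectors_def)

text \<open>Coordinate \<open>h\<close> is 1 in both vectors, which forces the scalar between them
  to be 1. Hence each projective point has at most one representative here, and points can be
  counted as vectors.\<close>

lemma span_torus_vector_eq_imp:
  assumes "v \<in> torus_vectors h" "w \<in> torus_vectors h" "v \<in> vec.span {w}"
  shows "v = w"
proof -
  obtain c where c: "v = c *s w"
    using assms(3) by (auto simp: vec.span_singleton)
  with assms(1,2) have "c = 1"
    by (simp add: torus_vectors_def)
  with c show ?thesis by simp
qed

lemma inj_on_span_torus_vectors:
  "inj_on (\<lambda>v. vec.span {v}) (torus_vectors h :: ('k::field ^ 'm::finite) set)"
  by (rule inj_onI) (metis insertI1 span_torus_vector_eq_imp vec.span_base)

text \<open>Coordinate \<open>h\<close> is fixed and the product equation determines one further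
  coordinate \<open>e\<close>; the other \<open>CARD('m) - 2\<close> coordinates range freely over
  the nonzero scalars.\<close>

lemma card_torus_vectors:
  assumes "CARD('m::finite) \<ge> 2"
  shows "card (torus_vectors h :: ('k::{field,finite} ^ 'm) set) = (CARD('k) - 1) ^ (CARD('m) - 2)"
proof -
  have "UNIV \<noteq> {h}"
  proof
    assume "UNIV = {h}"
    then have "CARD('m) = 1" by (metis card_1_singleton_iff One_nat_def)
    with assms show False by simp
  qed
  then obtain e where e: "e \<noteq> h"
    by auto
  define I where "I = UNIV - {h, e}"
  have UNIV_minus: "UNIV - {h} = insert e I" and eI: "e \<notin> I" "h \<notin> I"
    using e by (auto simp: I_def)
  \<comment> \<open>Extensional functions, so that restricting a vector to \<open>I\<close> inverts
    \<open>g\<close> exactly. For \<open>CARD('m) = 2\<close> the set \<open>I\<close> is empty and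
    its product is 1.\<close>
  define F :: "('m \<Rightarrow> 'k) set" where "F = (\<Pi>\<^sub>E i\<in>I. UNIV - {0})"
  define g :: "('m \<Rightarrow> 'k) \<Rightarrow> 'k ^ 'm" where
    "g f = (\<chi> i. if i = h then 1 else if i = e then inverse (\<Prod>j\<in>I. f j) else f i)" for f
  have prod_g: "(\<Prod>j\<in>I. g f $ j) = (\<Prod>j\<in>I. f j)" for f
    using eI by (intro prod.cong) (auto simp: g_def)
  have "bij_betw g F (torus_vectors h)"
  proof (rule bij_betw_byWitness[where f' = "\<lambda>v. restrict (($) v) I"])
    show "\<forall>f\<in>F. restrict (($) (g f)) I = f"
      using eI by (auto simp: F_def g_def fun_eq_iff restrict_def PiE_def extensional_def)
    show "\<forall>v\<in>torus_vectors h. g (restrict (($) v) I) = v"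
    proof
      fix v :: "'k ^ 'm" assume v: "v \<in> torus_vectors h"
      then have "v $ e * (\<Prod>j\<in>I. v $ j) = 1"
        using eI by (simp add: torus_vectors_def UNIV_minus)
      then have "inverse (\<Prod>j\<in>I. v $ j) = v $ e"
        by (metis inverse_unique mult.commute)
      with v show "g (restrict (($) v) I) = v"
        by (auto simp: g_def vec_eq_iff torus_vectors_def I_def)
    qed
    show "g ` F \<subseteq> torus_vectors h"
    proof safe
      fix f assume "f \<in> F"
      then have "(\<Prod>j\<in>I. f j) \<noteq> 0"
        by (auto simp: F_def PiE_def Pi_def)
      moreover have "g f $ e = inverse (\<Prod>j\<in>I. f j)" "g f $ h = 1"
        using e by (auto simp: g_def)
      ultimately show "g f \<in> torus_vectors h"
        using eI by (simp add: torus_vectors_def UNIV_minus prod_g)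
    qed
    show "(\<lambda>v. restrict (($) v) I) ` torus_vectors h \<subseteq> F"
    proof safe
      fix v :: "'k ^ 'm" assume "v \<in> torus_vectors h"
      then have "v $ e * (\<Prod>j\<in>I. v $ j) = 1"
        using eI by (simp add: torus_vectors_def UNIV_minus)
      then have "(\<Prod>j\<in>I. v $ j) \<noteq> 0"
        by (metis mult_zero_right zero_neq_one)
      then show "restrict (($) v) I \<in> F"
        by (auto simp: F_def)
    qed
  qed
  then have "card (torus_vectors h :: ('k ^ 'm) set) = card F"
    by (simp add: bij_betw_same_card)
  also have "\<dots> = (CARD('k) - 1) ^ card I"
    by (simp add: F_def card_PiE card_Diff_subset)
  also have "card I = CARD('m) - 2"
    using e by (simp add: I_def card_Diff_subset)
  finally show ?thesis .
qed

text \<open>Two distinct torus vectors in \<open>L\<close> span it, and the vectors of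
  \<open>L\<close> with coordinate \<open>h\<close> equal to 1 then form an affine line. Its
  parameters giving torus vectors solve an equation of degree at most
  \<open>CARD('m) - 1\<close>.\<close>

lemma card_torus_vectors_line_le:
  fixes L :: "('k::{field,finite} ^ 'm::finite) set"
  assumes L: "vec.subspace L" "vec.dim L = 2" and "CARD('m) \<ge> 2"
  shows "card (torus_vectors h \<inter> L) \<le> CARD('m) - 1"
proof (cases "\<exists>u\<in>torus_vectors h \<inter> L. \<exists>w\<in>torus_vectors h \<inter> L. u \<noteq> w")
  case False
  then have "card (torus_vectors h \<inter> L) \<le> 1"
    by (auto simp: card_le_Suc0_iff_eq)
  with assms(3) show ?thesis by linarith
next
  case True
  then obtain u w where uw: "u \<in> torus_vectors h" "u \<in> L" "w \<in> torus_vectors h" "w \<in> L" "u \<noteq> w"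
    by blast
  \<comment> \<open>Distinct torus vectors are never proportional.\<close>
  have "vec.independent {u, w}"
    using uw span_torus_vector_eq_imp[of u h w] torus_vectors_nonzero[of w h]
    by (auto simp: vec.independent_insert vec.dependent_single)
  then have span: "L \<subseteq> vec.span {u, w}"
    using uw L by (intro vec.card_ge_dim_independent) auto
  define d where "d = w - u"
  obtain i where i: "d $ i \<noteq> 0"
    using uw(5) by (metis d_def right_minus_eq vec_eq_iff zero_index)
  \<comment> \<open>The difference \<open>d\<close> vanishes at \<open>h\<close>, so the factor that
    is nonconstant in \<open>t\<close> really occurs in the product.\<close>
  then have "i \<in> UNIV - {h}"
    using uw by (auto simp: d_def torus_vectors_def)
  note roots = card_prod_affine_eq_one_le[where u = "($) u" and d = "($) d", OF _ this i]
  define T where "T = {t. (\<Prod>j\<in>UNIV - {h}. u $ j + t * d $ j) = 1}"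
  have "torus_vectors h \<inter> L \<subseteq> (\<lambda>t. u + t *s d) ` T"
  proof
    fix v assume v: "v \<in> torus_vectors h \<inter> L"
    with span obtain a b where ab: "v = a *s u + b *s w"
      by (auto simp: vec.span_insert vec.span_singleton algebra_simps)
    \<comment> \<open>Comparing coordinate \<open>h\<close> gives \<open>a + b = 1\<close>, which
      turns the linear combination into an affine one with parameter \<open>b\<close>.\<close>
    then have "v $ h = a * u $ h + b * w $ h"
      by simp
    then have "a = 1 - b"
      using v uw by (simp add: torus_vectors_def algebra_simps)
    with ab have v_eq: "v = u + b *s d"
      by (simp add: d_def vec_eq_iff algebra_simps)
    with v have "b \<in> T"
      by (simp add: T_def torus_vectors_def)
    with v_eq show "v \<in> (\<lambda>t. u + t *s d) ` T"
      by blast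
  qed
  then have "card (torus_vectors h \<inter> L) \<le> card T"
    by (rule surj_card_le[rotated]) simp
  also have "\<dots> \<le> card (UNIV - {h})"
    unfolding T_def by (rule roots) simp
  finally show ?thesis
    by (simp add: card_Diff_subset)
qed

theorem theorem2:
  fixes n q :: nat
  assumes "n \<ge> 2"
    and "primepow q"
    and "CARD('k::{field,finite}) = q"
    and "CARD('m::finite) = n + 1"
  shows "\<exists>X :: ('k ^ 'm) set set.
           rs_set n 1 X \<and>
           card X = (q - 1) ^ (n - 1) \<and>
           (\<forall>Y \<subseteq> X. card Y = n + 1 \<longrightarrow> \<not> pg_collinear Y)"
proof -
  \<comment> \<open>Any coordinate may serve as the one at infinity.\<close>
  obtain h :: 'm where True by blast
  define X :: "('k ^ 'm) set set" where "X = (\<lambda>v. vec.span {v}) ` torus_vectors h"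
  have points: "X \<subseteq> pg_points"
    by (auto simp: X_def pg_subspaces_def vec.dim_insert dest: torus_vectors_nonzero)
  have line: "card {P \<in> X. P \<subseteq> L} \<le> n" if "L \<in> pg_lines" for L
  proof -
    have L: "vec.subspace L" "vec.dim L = 2"
      using that by (auto simp: pg_subspaces_def)
    \<comment> \<open>A span contained in \<open>L\<close> has its generator in
      \<open>L\<close>.\<close>
    have "{P \<in> X. P \<subseteq> L} \<subseteq> (\<lambda>v. vec.span {v}) ` (torus_vectors h \<inter> L)"
      by (auto simp: X_def intro: vec.span_base)
    then have "card {P \<in> X. P \<subseteq> L} \<le> card (torus_vectors h \<inter> L)"
      by (rule surj_card_le[rotated]) simp
    also have "\<dots> \<le> n"
      using card_torus_vectors_line_le[OF L, of h] assms by simp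
    finally show ?thesis .
  qed
  have "card X = (q - 1) ^ (n - 1)"
    using assms by (simp add: X_def card_image[OF inj_on_span_torus_vectors] card_torus_vectors
        numeral_2_eq_2)
  moreover have "\<not> pg_collinear Y" if Y: "Y \<subseteq> X" "card Y = n + 1" for Y
  proof
    assume "pg_collinear Y"
    then obtain L where L: "L \<in> pg_lines" "\<forall>P\<in>Y. P \<subseteq> L"
      by (auto simp: pg_collinear_def)
    then have "card Y \<le> card {P \<in> X. P \<subseteq> L}"
      using Y by (intro card_mono) auto
    with line[OF L(1)] Y show False by simp
  qed
  ultimately show ?thesis
    using points line by (auto simp: rs_set_def)
qed

end
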